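(* Let $\epsilon\in(0,1/2)$, let $c=2\left\lceil\log\left(\lfloor 1/(2\epsilon)\rfloor+1\right)\right\rceil$, and let $n$ be a positive integer such that $\log n$ is an integer, $n>2c$ and $n\epsilon\ge 1$. Put $N=(n-2c)(n-c)=n^2-3cn+2c^2$. Then there exists a 2D $\epsilon$-balanced RC encoder with message length $N$, that is, a map $\mathrm{Enc}:\{0,1\}^N\to\{0,1\}^{n\times n}$ with $\mathrm{Enc}(x)\in\mathrm{Bal}_{\mathrm{RC}}(n;\epsilon)$ for all $x\in\{0,1\}^N$ together with a map $\mathrm{Dec}:\{0,1\}^{n\times n}\to\{0,1\}^N$ satisfying $\mathrm{Dec}(\mathrm{Enc}(x))=x$ for all $x\in\{0,1\}^N$. Its redundancy is $n^2-N=3cn-2c^2$ bits.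
   Context: Logarithms are to base 2. The weight of a binary sequence is its number of ones. A binary sequence of length $m$ is $\epsilon$-balanced if its weight lies in $[(1/2-\epsilon)m,(1/2+\epsilon)m]$. $\mathrm{Bal}_{\mathrm{RC}}(n;\epsilon)$ is the set of all $n\times n$ binary arrays in which every row and every column is $\epsilon$-balanced. The redundancy of an encoder $\{0,1\}^k\to\{0,1\}^{n\times n}$ is $n^2-k$. *)

theory Defs
  imports Complex_Main "HOL-Library.FuncSet"
begin

definition words :: "nat \<Rightarrow> bool list set" where
  "words m = {xs. length xs = m}"

text \<open>Arrays are lists of rows.\<close>

definition arrays :: "nat \<Rightarrow> bool list list set" where
  "arrays n = {A. length A = n \<and> set A \<subseteq> words n}"

definition weight :: "bool list \<Rightarrow> nat" where
  "weight xs = count_list xs True"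

definition balanced :: "real \<Rightarrow> bool list \<Rightarrow> bool" where
  "balanced \<epsilon> xs \<longleftrightarrow>
     real (weight xs) \<in> {(1/2 - \<epsilon>) * real (length xs) .. (1/2 + \<epsilon>) * real (length xs)}"

definition array_row :: "bool list list \<Rightarrow> nat \<Rightarrow> bool list" where
  "array_row A i = A ! i"

definition array_col :: "bool list list \<Rightarrow> nat \<Rightarrow> bool list" where
  "array_col A j = map (\<lambda>r. r ! j) A"

definition Bal_RC :: "nat \<Rightarrow> real \<Rightarrow> bool list list set" where
  "Bal_RC n \<epsilon> = {A \<in> arrays n.
     (\<forall>i<n. balanced \<epsilon> (array_row A i)) \<and> (\<forall>j<n. balanced \<epsilon> (array_col A j))}"

text \<open>The maps are total HOL functions; only their values on words of length \<open>k\<close>,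
  respectively on \<open>n \<times> n\<close> arrays, matter.\<close>

definition RC_encoder ::
  "nat \<Rightarrow> real \<Rightarrow> nat \<Rightarrow> (bool list \<Rightarrow> bool list list) \<Rightarrow> (bool list list \<Rightarrow> bool list) \<Rightarrow> bool" where
  "RC_encoder n \<epsilon> k Enc Dec \<longleftrightarrow>
     Enc \<in> words k \<rightarrow> arrays n \<and>
     Dec \<in> arrays n \<rightarrow> words k \<and>
     (\<forall>x \<in> words k. Enc x \<in> Bal_RC n \<epsilon>) \<and>
     (\<forall>x \<in> words k. Dec (Enc x) = x)"

text \<open>Redundancy of an encoder with message length \<open>k\<close> and \<open>n \<times> n\<close> output; it is
  integer-valued so that the subtraction does not truncate.\<close>

definition redundancy :: "nat \<Rightarrow> nat \<Rightarrow> int" where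
  "redundancy n k = (int n)^2 - int k"

end

theory Submission
  imports Defs
begin

text \<open>
  Put \<open>h = n/2\<close> and \<open>q = \<lfloor>\<epsilon>n\<rfloor> + 1\<close>, and classify the \<open>h \<times> h\<close> arrays by their row and column
  weights, each divided by \<open>q\<close> and rounded down. Each quotient takes at most
  \<open>\<lfloor>1/(2\<epsilon>)\<rfloor> + 1 \<le> 2^(c/2)\<close> values, so by pigeonhole some class \<open>K\<close> has at least \<open>2^(n^2/4 - cn/2)\<close>
  elements. For \<open>A, B, C, D \<in> K\<close> the block array with rows \<open>(A, \<not>B)\<close> and \<open>(\<not>C, D)\<close> is
  \<open>\<epsilon>\<close>-balanced, because corresponding weights within \<open>K\<close> differ by at most \<open>q - 1 \<le> \<epsilon>n\<close>. Hence
  \<open>Bal_RC n \<epsilon>\<close> has at least \<open>2^(n^2 - 2cn)\<close> elements, which is at least \<open>2^N\<close> as \<open>n \<ge> 2c\<close>, and any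
  injection of the messages into it is an encoder.
\<close>

section \<open>Counting words and arrays\<close>

lemma weight_append: "weight (xs @ ys) = weight xs + weight ys"
  by (simp add: weight_def)

lemma weight_le_length: "weight xs \<le> length xs"
  by (simp add: weight_def count_le_length)

lemma weight_map_Not: "weight (map Not xs) + weight xs = length xs"
  by (induction xs) (auto simp: weight_def)

lemma words_eq_lists: "words m = {xs. set xs \<subseteq> UNIV \<and> length xs = m}"
  by (simp add: words_def)

lemma arrays_eq_lists: "arrays m = {A. set A \<subseteq> words m \<and> length A = m}"
  by (auto simp: arrays_def)

lemma finite_words: "finite (words m)"
  unfolding words_eq_lists by (rule finite_lists_length_eq) simp

lemma card_words: "card (words m) = 2 ^ m"
  unfolding words_eq_lists by (subst card_lists_length_eq) (simp_all add: UNIV_bool numeral_2_eq_2)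

lemma finite_arrays: "finite (arrays m)"
  unfolding arrays_eq_lists by (rule finite_lists_length_eq) (rule finite_words)

lemma card_arrays: "card (arrays m) = 2 ^ (m * m)"
  unfolding arrays_eq_lists
  by (subst card_lists_length_eq) (simp_all add: finite_words card_words power_mult)

section \<open>Complements and two-by-two block arrays\<close>

definition complement :: "bool list list \<Rightarrow> bool list list" where
  "complement A = map (map Not) A"

definition block_array ::
  "bool list list \<Rightarrow> bool list list \<Rightarrow> bool list list \<Rightarrow> bool list list \<Rightarrow> bool list list" where
  "block_array A B C D = map2 (@) A B @ map2 (@) C D"

lemma complement_in_arrays: "A \<in> arrays h \<Longrightarrow> complement A \<in> arrays h"
  by (auto simp: arrays_def complement_def words_def)

lemma complement_inject: "complement A = complement B \<longleftrightarrow> A = B"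
  unfolding complement_def by (intro inj_map_eq_map inj_mapI) (auto simp: inj_def)

lemma length_arrays: "A \<in> arrays h \<Longrightarrow> length A = h"
  by (simp add: arrays_def)

lemma length_row: "A \<in> arrays h \<Longrightarrow> i < h \<Longrightarrow> length (A ! i) = h"
  using nth_mem by (fastforce simp: arrays_def words_def)

lemma length_array_row: "A \<in> arrays h \<Longrightarrow> i < h \<Longrightarrow> length (array_row A i) = h"
  by (simp add: array_row_def length_row)

lemma length_array_col: "A \<in> arrays h \<Longrightarrow> length (array_col A j) = h"
  by (simp add: array_col_def length_arrays)

lemma array_row_complement:
  "A \<in> arrays h \<Longrightarrow> i < h \<Longrightarrow> array_row (complement A) i = map Not (array_row A i)"
  by (simp add: array_row_def complement_def length_arrays)

lemma array_col_complement:
  assumes "A \<in> arrays h" "j < h"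
  shows "array_col (complement A) j = map Not (array_col A j)"
  using assms by (auto simp: array_col_def complement_def arrays_def words_def)

context
  fixes A B C D :: "bool list list" and h :: nat
  assumes blocks: "A \<in> arrays h" "B \<in> arrays h" "C \<in> arrays h" "D \<in> arrays h"
begin

lemma block_array_in_arrays: "block_array A B C D \<in> arrays (2 * h)"
  using blocks by (force simp: block_array_def arrays_def words_def dest: set_zip_leftD set_zip_rightD)

lemma array_row_block_array:
  "i < 2 * h \<Longrightarrow> array_row (block_array A B C D) i =
    (if i < h then array_row A i @ array_row B i
     else array_row C (i - h) @ array_row D (i - h))"
  by (simp add: array_row_def block_array_def nth_append length_arrays[OF blocks(1)]
      length_arrays[OF blocks(2)] length_arrays[OF blocks(3)] length_arrays[OF blocks(4)])

lemma array_col_block_array: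
  "j < 2 * h \<Longrightarrow> array_col (block_array A B C D) j =
    (if j < h then array_col A j @ array_col C j
     else array_col B (j - h) @ array_col D (j - h))"
  by (intro nth_equalityI)
     (auto simp: array_col_def block_array_def nth_append length_row[OF blocks(1)]
      length_row[OF blocks(2)] length_row[OF blocks(3)] length_row[OF blocks(4)]
      length_arrays[OF blocks(1)]
      length_arrays[OF blocks(2)] length_arrays[OF blocks(3)] length_arrays[OF blocks(4)])

end

text \<open>All rows have length \<open>h\<close>, so a concatenated row can be cut back into its
  two halves in only one way.\<close>

lemma map2_append_inject:
  assumes "A \<in> arrays h" "B \<in> arrays h" "A' \<in> arrays h" "B' \<in> arrays h"
    and eq: "map2 (@) A B = map2 (@) A' B'"
  shows "A = A' \<and> B = B'"
proof -
  have "A ! i = A' ! i \<and> B ! i = B' ! i" if "i < h" for i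
  proof -
    have "map2 (@) A B ! i = map2 (@) A' B' ! i"
      using eq by simp
    then show ?thesis
      using assms(1-4) that by (simp add: length_arrays length_row)
  qed
  then show ?thesis
    using assms(1-4) by (auto intro!: nth_equalityI simp: length_arrays)
qed

lemma block_array_inject:
  assumes "A \<in> arrays h" "B \<in> arrays h" "C \<in> arrays h" "D \<in> arrays h"
    and "A' \<in> arrays h" "B' \<in> arrays h" "C' \<in> arrays h" "D' \<in> arrays h"
    and "block_array A B C D = block_array A' B' C' D'"
  shows "A = A' \<and> B = B' \<and> C = C' \<and> D = D'"
proof -
  have "map2 (@) A B = map2 (@) A' B' \<and> map2 (@) C D = map2 (@) C' D'"
    using assms by (simp add: block_array_def length_arrays)
  then show ?thesis
    using assms map2_append_inject by blast
qed

section \<open>Coarse weight profiles and the pigeonhole principle\<close>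

definition profile :: "nat \<Rightarrow> nat \<Rightarrow> bool list list \<Rightarrow> nat list \<times> nat list" where
  "profile h q A = (map (\<lambda>i. weight (array_row A i) div q) [0..<h],
                    map (\<lambda>j. weight (array_col A j) div q) [0..<h])"

lemma profile_eqD:
  assumes "profile h q A = profile h q B" "i < h"
  shows "weight (array_row A i) div q = weight (array_row B i) div q"
    and "weight (array_col A i) div q = weight (array_col B i) div q"
  using assms by (auto simp: profile_def)

text \<open>Weights are at most \<open>h\<close>, so each of the \<open>2 * h\<close> quotients lies
  in \<open>{..h div q}\<close>, and some fibre of \<open>profile\<close> has at least average size.
  The bound is multiplied out to avoid dividing in the naturals.\<close>

lemma large_profile_class:
  "\<exists>K \<subseteq> arrays h. (\<forall>A\<in>K. \<forall>B\<in>K. profile h q A = profile h q B) \<and>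
     2 ^ (h * h) \<le> card K * (h div q + 1) ^ (2 * h)"
proof -
  define L where "L = {xs. set xs \<subseteq> {..h div q} \<and> length xs = h}"
  have "finite L"
    unfolding L_def by (rule finite_lists_length_eq) simp
  moreover have card_L: "card L = (h div q + 1) ^ h"
    unfolding L_def by (subst card_lists_length_eq) simp_all
  moreover have "L \<noteq> {}"
    using card_L by (metis card.empty add_is_0 power_not_zero one_neq_zero)
  moreover have "profile h q \<in> arrays h \<rightarrow> L \<times> L"
  proof
    fix A assume "A \<in> arrays h"
    then have "weight (array_row A i) \<le> h" "weight (array_col A i) \<le> h" if "i < h" for i
      using that weight_le_length by (metis length_array_row, metis length_array_col)
    then show "profile h q A \<in> L \<times> L"
      by (auto simp: profile_def L_def intro!: div_le_mono)
  qed
  ultimately obtain y where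
    "card (arrays h) \<le> card (profile h q -` {y} \<inter> arrays h) * card (L \<times> L)"
    using pigeonhole_card[of "profile h q" "arrays h" "L \<times> L"] finite_arrays
    by (metis finite_cartesian_product Times_empty)
  then show ?thesis
    by (intro exI[of _ "profile h q -` {y} \<inter> arrays h"])
       (auto simp: card_arrays card_cartesian_product card_L mult_2 power_add)
qed

text \<open>Equal quotients put both numbers into the same run of \<open>q\<close> consecutive
  naturals.\<close>

lemma nat_diff_if_div_eq:
  fixes a b q :: nat
  assumes "a div q = b div q" "q > 0"
  shows "a < b + q"
proof -
  have "a = b div q * q + a mod q"
    by (simp flip: assms(1))
  moreover have "b div q * q \<le> b" "a mod q < q"
    using assms(2) by simp_all
  ultimately show ?thesis
    by linarith
qed

text \<open>The weight of \<open>xs @ map Not ys\<close> is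
  \<open>h + weight xs - weight ys\<close>, so its distance from half the length is at most
  \<open>q - 1\<close>.\<close>

lemma balanced_append_Not:
  assumes "length xs = h" "length ys = h" "weight xs div q = weight ys div q"
    and "q > 0" "real q \<le> \<epsilon> * real (2 * h) + 1"
  shows "balanced \<epsilon> (xs @ map Not ys)" and "balanced \<epsilon> (map Not xs @ ys)"
proof -
  have "weight xs < weight ys + q" "weight ys < weight xs + q"
    using assms nat_diff_if_div_eq by metis+
  \<comment> \<open>Strictness over the naturals is traded for the \<open>+ 1\<close> that matches
    the one in the bound on \<open>q\<close>.\<close>
  then have "real (weight xs) + 1 \<le> real (weight ys) + real q"
    "real (weight ys) + 1 \<le> real (weight xs) + real q"
    by linarith+
  moreover have "real (weight (map Not xs)) + real (weight xs) = real h"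
    "real (weight (map Not ys)) + real (weight ys) = real h"
    using weight_map_Not[of xs] weight_map_Not[of ys] assms(1,2)
    by (metis of_nat_add)+
  ultimately show "balanced \<epsilon> (xs @ map Not ys)" and "balanced \<epsilon> (map Not xs @ ys)"
    using assms(1,2,5) by (auto simp: balanced_def weight_append algebra_simps)
qed

text \<open>The complemented blocks sit on the antidiagonal, so every row and every column joins one
  plain and one complemented half.\<close>

lemma block_array_in_Bal_RC:
  assumes "A \<in> arrays h" "B \<in> arrays h" "C \<in> arrays h" "D \<in> arrays h"
    and prof: "profile h q B = profile h q A" "profile h q C = profile h q A"
      "profile h q D = profile h q A"
    and q: "q > 0" "real q \<le> \<epsilon> * real (2 * h) + 1"
  shows "block_array A (complement B) (complement C) D \<in> Bal_RC (2 * h) \<epsilon>"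
proof -
  let ?M = "block_array A (complement B) (complement C) D"
  note blocks = assms(1) complement_in_arrays[OF assms(2)]
    complement_in_arrays[OF assms(3)] assms(4)
  have "balanced \<epsilon> (array_row ?M i)" if "i < 2 * h" for i
  proof (cases "i < h")
    case True
    then show ?thesis
      using assms(1-4) q profile_eqD(1)[OF prof(1)]
      by (auto simp: array_row_block_array[OF blocks that] array_row_complement length_array_row
          intro!: balanced_append_Not(1))
  next
    case False
    then have "i - h < h" using that by simp
    \<comment> \<open>\<open>C\<close> and \<open>D\<close> are compared through
      \<open>A\<close>.\<close>
    then show ?thesis
      using False assms(1-4) q profile_eqD(1)[OF prof(2)] profile_eqD(1)[OF prof(3)]
      by (auto simp: array_row_block_array[OF blocks that] array_row_complement length_array_row
          intro!: balanced_append_Not(2))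
  qed
  moreover have "balanced \<epsilon> (array_col ?M j)" if "j < 2 * h" for j
  proof (cases "j < h")
    case True
    then show ?thesis
      using assms(1-4) q profile_eqD(2)[OF prof(2)]
      by (auto simp: array_col_block_array[OF blocks that] array_col_complement length_array_col
          intro!: balanced_append_Not(1))
  next
    case False
    then have "j - h < h" using that by simp
    then show ?thesis
      using False assms(1-4) q profile_eqD(2)[OF prof(1)] profile_eqD(2)[OF prof(3)]
      by (auto simp: array_col_block_array[OF blocks that] array_col_complement length_array_col
          intro!: balanced_append_Not(2))
  qed
  ultimately show ?thesis
    using block_array_in_arrays[OF blocks] by (simp add: Bal_RC_def)
qed

section \<open>Counting balanced arrays\<close>

lemma finite_Bal_RC: "finite (Bal_RC n \<epsilon>)"
  using finite_arrays by (simp add: Bal_RC_def)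

text \<open>The four blocks range over \<open>K\<close> independently and can be recovered from the
  array.\<close>

lemma card_Bal_RC_ge_power4:
  assumes "K \<subseteq> arrays h" "\<And>A B. A \<in> K \<Longrightarrow> B \<in> K \<Longrightarrow> profile h q A = profile h q B"
    and "q > 0" "real q \<le> \<epsilon> * real (2 * h) + 1"
  shows "card K ^ 4 \<le> card (Bal_RC (2 * h) \<epsilon>)"
proof -
  let ?f = "\<lambda>(A, B, C, D). block_array A (complement B) (complement C) D"
  have "inj_on ?f (K \<times> K \<times> K \<times> K)"
  proof (rule inj_onI, clarsimp)
    fix A B C D A' B' C' D'
    assume *: "A \<in> K" "B \<in> K" "C \<in> K" "D \<in> K" "A' \<in> K" "B' \<in> K" "C' \<in> K" "D' \<in> K"
      and eq: "block_array A (complement B) (complement C) D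
        = block_array A' (complement B') (complement C') D'"
    have "A = A' \<and> complement B = complement B' \<and> complement C = complement C' \<and> D = D'"
      using * assms(1) by (intro block_array_inject[OF _ _ _ _ _ _ _ _ eq])
        (auto intro!: complement_in_arrays)
    then show "A = A' \<and> B = B' \<and> C = C' \<and> D = D'"
      by (simp add: complement_inject)
  qed
  moreover have "?f ` (K \<times> K \<times> K \<times> K) \<subseteq> Bal_RC (2 * h) \<epsilon>"
    using assms by (auto intro!: block_array_in_Bal_RC)
  ultimately have "card (K \<times> K \<times> K \<times> K) \<le> card (Bal_RC (2 * h) \<epsilon>)"
    by (intro card_inj_on_le finite_Bal_RC)
  then show ?thesis
    by (simp add: card_cartesian_product power4_eq_xxxx mult.assoc)
qed

text \<open>A profile has \<open>2 * h = n\<close> entries of at most \<open>d\<close> bits each;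
  the factor 4 counts the blocks.\<close>

lemma card_Bal_RC_ge:
  assumes "0 < \<epsilon>" and "n = 2 * h" and d: "real_of_int \<lfloor>1 / (2 * \<epsilon>)\<rfloor> + 1 \<le> 2 ^ d"
  shows "2 ^ (n * n) \<le> card (Bal_RC n \<epsilon>) * 2 ^ (4 * d * n)"
proof -
  \<comment> \<open>The largest integer allowed by the balance condition; it still exceeds
    \<open>\<epsilon> * n\<close>, which keeps the number of quotients small.\<close>
  define q where "q = nat \<lfloor>\<epsilon> * real n\<rfloor> + 1"
  have q_eq: "real q = real_of_int \<lfloor>\<epsilon> * real n\<rfloor> + 1"
    using \<open>0 < \<epsilon>\<close> by (simp add: q_def)
  then have q: "q > 0" "real q \<le> \<epsilon> * real (2 * h) + 1" "\<epsilon> * real n < real q"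
    using \<open>n = 2 * h\<close> by (simp add: q_def, simp, linarith)
  have "real (h div q) * (\<epsilon> * real n) \<le> real (h div q) * real q"
    using q(3) by (intro mult_left_mono) auto
  also have "\<dots> \<le> real h"
    by (metis of_nat_mult of_nat_le_iff div_times_less_eq_dividend)
  finally have "real h * (2 * \<epsilon> * real (h div q)) \<le> real h * 1"
    using \<open>n = 2 * h\<close> by (simp add: algebra_simps)
  \<comment> \<open>Cancelling \<open>h\<close> needs \<open>h\<close> nonzero; for
    \<open>h = 0\<close> the quotient is 0.\<close>
  then have "real (h div q) \<le> 1 / (2 * \<epsilon>)"
    using \<open>0 < \<epsilon>\<close> by (cases "h = 0") (simp_all add: field_simps)
  then have "int (h div q) \<le> \<lfloor>1 / (2 * \<epsilon>)\<rfloor>"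
    by (simp add: le_floor_iff)
  then have "real (h div q + 1) \<le> real (2 ^ d)"
    using d by simp
  then have buckets: "h div q + 1 \<le> 2 ^ d"
    by (simp only: of_nat_le_iff)
  obtain K where K: "K \<subseteq> arrays h" "\<And>A B. A \<in> K \<Longrightarrow> B \<in> K \<Longrightarrow> profile h q A = profile h q B"
    "2 ^ (h * h) \<le> card K * (h div q + 1) ^ (2 * h)"
    using large_profile_class[of h q] by blast
  note K(3)
  also have "card K * (h div q + 1) ^ (2 * h) \<le> card K * (2 ^ d) ^ n"
    unfolding \<open>n = 2 * h\<close> using buckets by (intro mult_left_mono power_mono) simp_all
  \<comment> \<open>The fourth power turns \<open>h * h\<close> into \<open>n * n\<close>.\<close>
  finally have "(2 ^ (h * h)) ^ 4 \<le> (card K * (2 ^ d) ^ n) ^ 4"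
    by (rule power_mono) simp
  also have "\<dots> = card K ^ 4 * 2 ^ (4 * d * n)"
    by (simp add: power_mult_distrib mult_ac flip: power_mult)
  also have "\<dots> \<le> card (Bal_RC n \<epsilon>) * 2 ^ (4 * d * n)"
    using card_Bal_RC_ge_power4[OF K(1,2) q(1,2)] \<open>n = 2 * h\<close> by simp
  finally show ?thesis
    using \<open>n = 2 * h\<close> by (simp add: algebra_simps flip: power_mult)
qed

section \<open>From cardinality to an encoder\<close>

lemma RC_encoder_exists_if_card_le:
  assumes "2 ^ k \<le> card (Bal_RC n \<epsilon>)"
  shows "\<exists>Enc Dec. RC_encoder n \<epsilon> k Enc Dec"
proof -
  obtain Enc where Enc: "Enc ` words k \<subseteq> Bal_RC n \<epsilon>" "inj_on Enc (words k)"
    using card_le_inj[OF finite_words finite_Bal_RC] assms by (metis card_words)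
  \<comment> \<open>The default word keeps \<open>Dec\<close> inside \<open>words k\<close> on
    arrays that encode no message.\<close>
  define Dec where "Dec M = (if M \<in> Enc ` words k then inv_into (words k) Enc M
    else replicate k False)" for M
  have "Enc \<in> words k \<rightarrow> arrays n"
    using Enc(1) by (auto simp: Bal_RC_def)
  moreover have "Dec \<in> arrays n \<rightarrow> words k"
    by (auto simp: Dec_def inv_into_into) (simp add: words_def)
  ultimately have "RC_encoder n \<epsilon> k Enc Dec"
    using Enc by (auto simp: RC_encoder_def Dec_def)
  then show ?thesis
    by blast
qed

theorem mainTheorem2:
  fixes \<epsilon> :: real and c n N :: nat
  assumes "0 < \<epsilon>" and "\<epsilon> < 1/2"
    and "c = 2 * nat \<lceil>log 2 (real_of_int \<lfloor>1 / (2 * \<epsilon>)\<rfloor> + 1)\<rceil>"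
    and "n > 0"
    and "log 2 (real n) \<in> \<int>"
    and "n > 2 * c"
    and "real n * \<epsilon> \<ge> 1"
    and "N = (n - 2 * c) * (n - c)"
  shows "int N = (int n)^2 - 3 * int c * int n + 2 * (int c)^2 \<and>
    (\<exists>Enc Dec. RC_encoder n \<epsilon> N Enc Dec) \<and>
    redundancy n N = 3 * int c * int n - 2 * (int c)^2"
proof -
  define F where "F = real_of_int \<lfloor>1 / (2 * \<epsilon>)\<rfloor> + 1"
  define d where "d = nat \<lceil>log 2 F\<rceil>"
  have c: "c = 2 * d"
    using assms(3) by (simp add: F_def d_def)
  have "1 \<le> \<lfloor>1 / (2 * \<epsilon>)\<rfloor>"
    using assms(1,2) by (simp add: le_floor_iff)
  then have F: "2 \<le> F"
    by (simp add: F_def)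
  have log_le: "log 2 F \<le> real d"
    unfolding d_def by (rule real_nat_ceiling_ge)
  have "F = 2 powr log 2 F"
    using F by simp
  also have "\<dots> \<le> 2 powr real d"
    using log_le by (intro powr_mono) auto
  finally have F_le: "F \<le> 2 ^ d"
    by (simp add: powr_realpow)
  \<comment> \<open>With \<open>d\<close> positive, \<open>n > 2 * c\<close> gives
    \<open>n > 1\<close>, so the power of two \<open>n\<close> has a positive exponent and is
    even.\<close>
  have "d \<noteq> 0"
    using F F_le by (intro notI) simp
  then have "n > 1"
    using \<open>n > 2 * c\<close> c by simp
  obtain k where k: "log 2 (real n) = real_of_int k"
    using assms(5) by (auto elim: Ints_cases)
  moreover have "log 2 (real n) > 0"
    using \<open>n > 1\<close> by simp
  ultimately have "k > 0"
    by simp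
  have "real n = 2 powr real_of_int k"
    using \<open>n > 0\<close> by (simp flip: k)
  also have "\<dots> = 2 ^ nat k"
    using \<open>k > 0\<close> by (simp flip: powr_realpow)
  finally have "n = 2 ^ nat k"
    by (metis of_nat_eq_iff of_nat_power of_nat_numeral)
  then obtain h where h: "n = 2 * h"
    using \<open>k > 0\<close> by (metis dvdE dvd_power zero_less_nat_eq)
  have intN: "int N = (int n)^2 - 3 * int c * int n + 2 * (int c)^2"
  proof -
    have "int N = (int n - 2 * int c) * (int n - int c)"
      using assms(6,8) by (simp add: of_nat_diff)
    then show ?thesis
      by (simp add: power2_eq_square algebra_simps)
  qed
  \<comment> \<open>Since \<open>4 * d * n = 2 * c * n\<close>, the exponent inequality below
    reduces to \<open>2 * c * c \<le> c * n\<close>.\<close>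
  have "int c * (2 * int c) \<le> int c * int n"
    using assms(6) by (intro mult_left_mono) auto
  then have "int (N + 4 * d * n) \<le> int (n * n)"
    using intN by (simp add: c power2_eq_square algebra_simps)
  then have exponent: "N + 4 * d * n \<le> n * n"
    by linarith
  have "2 ^ N * 2 ^ (4 * d * n) \<le> (2 :: nat) ^ (n * n)"
    using exponent by (simp flip: power_add)
  also have "\<dots> \<le> card (Bal_RC n \<epsilon>) * 2 ^ (4 * d * n)"
    using card_Bal_RC_ge[OF assms(1) h] F_le by (simp add: F_def)
  finally have "2 ^ N \<le> card (Bal_RC n \<epsilon>)"
    by simp
  then show ?thesis
    using RC_encoder_exists_if_card_le intN by (auto simp: redundancy_def)
qed

end
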